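(* Let $\ell\geq 5$ be an integer and let $G$ be a finite simple graph with girth exactly $2\ell$ that has no even hole of length at least $2\ell+2$. Then $G$ is $3$-colorable, i.e. $\chi(G)\leq 3$.
   Context: The girth of a graph is the minimum length of a cycle in it. A hole is an induced cycle of length at least four; it is even if its length is even. A graph is $3$-colorable if its vertices can be assigned colors from a set of size $3$ so that adjacent vertices receive different colors. *)

theory Defs
  imports "Graph_Theory.Graph_Theory" "HOL-Library.Extended_Nat"
begin

text \<open>
  A finite simple graph is a \<^locale>\<open>pair_graph\<close>: a finite vertex set with a symmetric,
  irreflexive arc relation, each edge being represented by its two opposite arcs.
  Hence \<^const>\<open>pre_digraph.cycle\<close> also admits the closed walk \<open>u, v, u\<close> along a single
  edge; requiring length at least three leaves exactly the cycles of the undirected graph.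
\<close>

definition graph_cycle :: "'a pair_pre_digraph \<Rightarrow> ('a \<times> 'a) awalk \<Rightarrow> bool" where
  "graph_cycle G p \<longleftrightarrow> pre_digraph.cycle (with_proj G) p \<and> 3 \<le> length p"

text \<open>The girth of an acyclic graph is \<open>\<infinity>\<close>, the infimum of the empty set.\<close>

definition girth :: "'a pair_pre_digraph \<Rightarrow> enat" where
  "girth G = (INF p\<in>{p. graph_cycle G p}. enat (length p))"

definition cycle_subgraph :: "('a \<times> 'a) awalk \<Rightarrow> 'a pair_pre_digraph" where
  "cycle_subgraph p = \<lparr> pverts = fst ` set p, parcs = set p \<union> (set p)\<inverse> \<rparr>"

definition hole :: "'a pair_pre_digraph \<Rightarrow> ('a \<times> 'a) awalk \<Rightarrow> bool" where
  "hole G p \<longleftrightarrow> graph_cycle G p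
     \<and> induced_subgraph (with_proj (cycle_subgraph p)) (with_proj G) \<and> 4 \<le> length p"

definition even_hole :: "'a pair_pre_digraph \<Rightarrow> ('a \<times> 'a) awalk \<Rightarrow> bool" where
  "even_hole G p \<longleftrightarrow> hole G p \<and> even (length p)"

definition colorable :: "nat \<Rightarrow> 'a pair_pre_digraph \<Rightarrow> bool" where
  "colorable k G \<longleftrightarrow> (\<exists>c :: 'a \<Rightarrow> nat.
     (\<forall>v \<in> pverts G. c v \<in> {..<k}) \<and> (\<forall>(u, v) \<in> parcs G. c u \<noteq> c v))"

end

theory Submission
  imports Defs
begin

text \<open>
  It suffices that a graph of girth at least \<open>2l\<close> in which every even hole has length exactly
  \<open>2l\<close> has a vertex of degree at most two, as this class is closed under induced subgraphs.
  Suppose all degrees are at least three. Among all components \<open>B\<close> of \<open>G - N[K]\<close>, where \<open>K\<close>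
  consists of a vertex and some of its neighbours, take one of least size. If \<open>r\<close> and three
  neighbours \<open>y\<^sub>1, y\<^sub>2, y\<^sub>3\<close> of \<open>r\<close> lie in \<open>B\<close>, then by minimality the rest of \<open>B \<union> N(K)\<close> lies in
  a single component of the graph without the closed neighbourhood of these four vertices. Two
  of any three vertices of a connected triangle-free graph are joined by an induced path of even
  length; hence for any further neighbours \<open>z\<^sub>i\<close> of the \<open>y\<^sub>i\<close>, some path
  \<open>z\<^sub>i y\<^sub>i r y\<^sub>j z\<^sub>j\<close> extends to an even hole, so to a cycle of length \<open>2l\<close>.

  On the other hand, two distinct \<open>2l\<close>-cycles that share a path with two edges share exactly a
  path of length \<open>l\<close>. So two of these cycles through \<open>y\<^sub>i r y\<^sub>j\<close> cannot differ both at \<open>z\<^sub>i\<close> and at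
  \<open>z\<^sub>j\<close>; and if they differ at \<open>z\<^sub>j\<close> only, then \<open>y\<^sub>j\<close> is an end of three paths of length \<open>l\<close> with
  a common other end, which is impossible by the same argument at \<open>y\<^sub>j\<close>. Hence each pair
  \<open>y\<^sub>i, y\<^sub>j\<close> admits at most one such cycle, and the \<open>z\<^sub>i\<close> can be chosen to avoid all of them.
\<close>

section \<open>Induced paths and cycles\<close>

definition path_in :: "('a \<Rightarrow> 'a \<Rightarrow> bool) \<Rightarrow> 'a list \<Rightarrow> bool" where
  "path_in A p \<longleftrightarrow> p \<noteq> [] \<and> distinct p \<and> successively A p"

definition cycle_in :: "('a \<Rightarrow> 'a \<Rightarrow> bool) \<Rightarrow> 'a list \<Rightarrow> bool" where
  "cycle_in A c \<longleftrightarrow> 3 \<le> length c \<and> distinct c \<and> successively A c \<and> A (last c) (hd c)"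

definition chordless :: "('a \<Rightarrow> 'a \<Rightarrow> bool) \<Rightarrow> 'a list \<Rightarrow> bool" where
  "chordless A c \<longleftrightarrow> (\<forall>i j. i < j \<longrightarrow> j < length c \<longrightarrow> A (c ! i) (c ! j)
     \<longrightarrow> j = Suc i \<or> i = 0 \<and> Suc j = length c)"

primrec ind_path :: "('a \<Rightarrow> 'a \<Rightarrow> bool) \<Rightarrow> 'a list \<Rightarrow> bool" where
  "ind_path A [] \<longleftrightarrow> True"
| "ind_path A (x # p) \<longleftrightarrow> x \<notin> set p \<and> (\<forall>y\<in>set p. A x y \<longleftrightarrow> y = hd p) \<and> ind_path A p"

lemma ind_path_append_iff:
  "ind_path A (p @ q) \<longleftrightarrow> ind_path A p \<and> ind_path A q \<and> set p \<inter> set q = {}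
     \<and> (\<forall>x\<in>set p. \<forall>y\<in>set q. A x y \<longleftrightarrow> x = last p \<and> y = hd q)"
proof (induction p)
  case (Cons a p)
  show ?case
  proof (cases "p = []")
    case False
    then have "hd (p @ q) = hd p" "last (a # p) = last p" "last p \<in> set p" "hd p \<in> set p" by auto
    then show ?thesis using Cons by auto
  qed auto
qed auto

lemma ind_path_imp_path:
  assumes "ind_path A p"
  shows "distinct p" "successively A p"
  using assms
proof (induction p)
  case (Cons x p)
  { case 1 then show ?case using Cons by simp }
  { case 2 then show ?case using Cons by (cases p) auto }
qed auto

lemma ind_path_nth:
  assumes "ind_path A p" "i < j" "j < length p"
  shows "A (p ! i) (p ! j) \<longleftrightarrow> j = Suc i"
  using assms
proof (induction p arbitrary: i j)
  case (Cons x p)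
  have d: "distinct p" using Cons.prems(1) ind_path_imp_path by auto
  show ?case
  proof (cases i)
    case 0
    obtain j' where j: "j = Suc j'" "j' < length p" using Cons.prems by (cases j) auto
    then have "p ! j' = hd p \<longleftrightarrow> j' = 0"
      using d by (metis hd_conv_nth length_0_conv less_nat_zero_code nth_eq_iff_index_eq gr_zeroI)
    then show ?thesis using Cons.prems j 0 by auto
  next
    case (Suc i')
    obtain j' where j: "j = Suc j'" "j' < length p" using Cons.prems by (cases j) auto
    then show ?thesis using Cons.prems Cons.IH[of i' j'] Suc by auto
  qed
qed simp

locale sym_adj =
  fixes A :: "'a \<Rightarrow> 'a \<Rightarrow> bool"
  assumes sym: "A x y \<Longrightarrow> A y x" and irrefl: "\<not> A x x"
begin

lemma sym_iff: "A x y \<longleftrightarrow> A y x"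
  using sym by blast

lemma neq: "A x y \<Longrightarrow> x \<noteq> y"
  using irrefl by blast

lemma successively_rev: "successively A (rev p) \<longleftrightarrow> successively A p"
proof -
  have "(\<lambda>x y. A y x) = A" using sym by blast
  then show ?thesis by (metis List.successively_rev)
qed

lemma ind_path_rev: "ind_path A (rev p) \<longleftrightarrow> ind_path A p"
proof (induction p)
  case (Cons x p)
  have "(\<forall>y\<in>set p. A y x \<longleftrightarrow> y = last (rev p)) \<longleftrightarrow> (\<forall>y\<in>set p. A x y \<longleftrightarrow> y = hd p)"
    by (cases "p = []") (auto simp: last_rev sym_iff)
  then show ?case using Cons by (auto simp: ind_path_append_iff)
qed simp

text \<open>Induction on a walk: a new starting vertex is joined to its last neighbour on the induced
  path constructed so far.\<close>

lemma ind_path_to: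
  assumes "(\<lambda>a b. A a b \<and> a \<in> S \<and> b \<in> S)\<^sup>*\<^sup>* x t" "t \<in> T" "x \<in> S"
  shows "\<exists>p. p \<noteq> [] \<and> ind_path A p \<and> hd p = x \<and> last p \<in> T \<and> set p \<subseteq> S
    \<and> (\<forall>u\<in>set (butlast p). u \<notin> T)"
  using assms
proof (induction rule: converse_rtranclp_induct)
  case base
  then show ?case by (intro exI[of _ "[t]"]) auto
next
  case (step x y)
  then obtain p where p: "p \<noteq> []" "ind_path A p" "hd p = y" "last p \<in> T" "set p \<subseteq> S"
    "\<forall>u\<in>set (butlast p). u \<notin> T" by blast
  consider "x \<in> T" | "x \<notin> T" "x \<in> set p" | "x \<notin> T" "x \<notin> set p" by blast
  then show ?case
  proof cases
    case 1
    then show ?thesis using step by (intro exI[of _ "[x]"]) auto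
  next
    case 2
    then obtain a b where "p = a @ x # b" by (meson split_list)
    then show ?thesis using p by (intro exI[of _ "x # b"]) (auto simp: ind_path_append_iff butlast_append)
  next
    case 3
    have "\<exists>u\<in>set p. A x u" using p step by (metis list.set_sel(1))
    then obtain a u b where u: "p = a @ u # b" "A x u" "\<forall>z\<in>set b. \<not> A x z"
      by (rule split_list_last_propE)
    have "ind_path A (x # u # b)" using p u 3 by (auto simp: ind_path_append_iff)
    then show ?thesis using p u 3 step
      by (intro exI[of _ "x # u # b"]) (auto simp: butlast_append)
  qed
qed

text \<open>A chord avoiding \<open>w\<close> would be a chord of \<open>p\<close>, and
  \<open>w\<close> sees only the ends of \<open>p\<close>. At the head of the list \<open>w\<close>
  has index 0, so its edge to \<open>last p\<close> falls under the wrap-around clause of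
  \<open>chordless\<close>.\<close>

lemma closing_vertex_hole:
  assumes "ind_path A p" "2 \<le> length p" "w \<notin> set p" "\<forall>u\<in>set p. A w u \<longleftrightarrow> u = hd p \<or> u = last p"
  shows "cycle_in A (w # p) \<and> chordless A (w # p)"
proof
  have ne: "p \<noteq> []" using assms by auto
  note d = ind_path_imp_path[OF assms(1)]
  have "A w (hd p)" "A (last p) w" using assms(4) ne sym by auto
  then show "cycle_in A (w # p)"
    using assms ne d by (auto simp: cycle_in_def successively_Cons)
  show "chordless A (w # p)"
    unfolding chordless_def
  proof (intro allI impI)
    fix i j assume ij: "i < j" "j < length (w # p)" "A ((w # p) ! i) ((w # p) ! j)"
    then obtain j' where j: "j = Suc j'" "j' < length p" by (cases j) auto
    show "j = Suc i \<or> i = 0 \<and> Suc j = length (w # p)"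
    proof (cases i)
      case 0
      then have "p ! j' = hd p \<or> p ! j' = last p" using assms(4) ij j by auto
      then have "j' = 0 \<or> Suc j' = length p"
        using d(1) j ne
        by (metis hd_conv_nth last_conv_nth length_greater_0_conv nth_eq_iff_index_eq
            Suc_diff_1 diff_less zero_less_one)
      then show ?thesis using j 0 by auto
    next
      case (Suc i')
      then show ?thesis using ij j ind_path_nth[OF assms(1), of i' j'] by auto
    qed
  qed
qed

end

lemma distinct_split_unique:
  assumes "distinct (a @ x # c)" "a @ x # c = d @ x # e"
  shows "c = e"
  using assms
proof (induction a arbitrary: d)
  case Nil
  then show ?case by (cases d) auto
next
  case (Cons z a)
  show ?case
  proof (cases d)
    case d: (Cons y d')
    have "distinct (a @ x # c)" using Cons.prems(1) by simp
    moreover have "a @ x # c = d' @ x # e" using Cons.prems(2) d by simp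
    ultimately show ?thesis by (rule Cons.IH)
  qed (use Cons.prems in auto)
qed

context sym_adj begin

text \<open>Follow an induced path from \<open>z3\<close> up to the first vertex \<open>q\<close> with a neighbour on an induced
  path \<open>P\<close> from \<open>z1\<close> to \<open>z2\<close>. Branching at \<open>q\<close>, or on \<open>P\<close> if \<open>q\<close> has only one neighbour there,
  gives three induced paths whose numbers of vertices have an odd sum.\<close>

lemma even_ind_path:
  assumes tf: "\<And>x y z. A x y \<Longrightarrow> A y z \<Longrightarrow> A z x \<Longrightarrow> False"
    and con: "(\<lambda>a b. A a b \<and> a \<in> Y \<and> b \<in> Y)\<^sup>*\<^sup>* z1 z2" "(\<lambda>a b. A a b \<and> a \<in> Y \<and> b \<in> Y)\<^sup>*\<^sup>* z3 z1"
    and Y: "z1 \<in> Y" "z2 \<in> Y" "z3 \<in> Y"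
  shows "\<exists>p. p \<noteq> [] \<and> ind_path A p \<and> set p \<subseteq> Y \<and> odd (length p)
    \<and> (hd p = z1 \<and> last p = z2 \<or> hd p = z1 \<and> last p = z3 \<or> hd p = z2 \<and> last p = z3)"
proof -
  obtain P where P: "P \<noteq> []" "ind_path A P" "hd P = z1" "last P = z2" "set P \<subseteq> Y"
    using ind_path_to[OF con(1), of "{z2}"] Y by auto
  \<comment> \<open>Closed neighbourhood of \<open>P\<close>. Stopping \<open>Q\<close> at its first
    vertex in \<open>T\<close> ensures that only \<open>q\<close> can lie on \<open>P\<close> or see
    it.\<close>
  define T where "T = {u. u \<in> set P \<or> (\<exists>v\<in>set P. A u v)}"
  have "z1 \<in> T" using P hd_in_set unfolding T_def by fastforce
  from ind_path_to[OF con(2) this Y(3)]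
  obtain Q where Q: "Q \<noteq> []" "ind_path A Q" "hd Q = z3" "last Q \<in> T" "set Q \<subseteq> Y"
    "\<forall>u\<in>set (butlast Q). u \<notin> T" by blast
  note dP = ind_path_imp_path(1)[OF P(2)] and dQ = ind_path_imp_path(1)[OF Q(2)]
  define q where "q = last Q"
  obtain Q' where Q': "Q = Q' @ [q]" using Q(1) q_def by (metis append_butlast_last_id)
  have bl: "butlast Q = Q'" using Q' by simp
  show ?thesis
  proof (cases "q \<in> set P")
    case True
    \<comment> \<open>The predecessor of \<open>q\<close> on \<open>Q\<close> would see
      \<open>P\<close> and lie in \<open>T\<close>. So \<open>Q\<close> is just \<open>z3\<close>,
      and \<open>z3\<close> lies on \<open>P\<close>.\<close>
    have "Q' = []"
    proof (rule ccontr)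
      assume ne: "Q' \<noteq> []"
      have "A (last Q') q" using ne Q(2) Q' by (auto simp: ind_path_append_iff)
      then have "last Q' \<in> T" using True unfolding T_def by blast
      then show False using Q(6) bl ne by auto
    qed
    then have "z3 \<in> set P" using True Q(3) Q' by simp
    then obtain a b where ab: "P = a @ z3 # b" by (meson split_list)
    have i: "ind_path A (a @ [z3])" "ind_path A (rev (z3 # b))"
      using P(2) unfolding ab ind_path_rev by (auto simp: ind_path_append_iff)
    have h: "hd (a @ [z3]) = z1" "hd (rev (z3 # b)) = z2"
      using P(3,4) unfolding ab by (auto simp: hd_append hd_rev)
    have s: "set (a @ [z3]) \<subseteq> Y" "set (rev (z3 # b)) \<subseteq> Y" using P(5) ab by auto
    have "odd (length (a @ [z3])) \<or> odd (length (rev (z3 # b))) \<or> odd (length P)"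
      unfolding ab by auto
    then show ?thesis
    proof (elim disjE)
      assume "odd (length (a @ [z3]))"
      then show ?thesis using i h s by (intro exI[of _ "a @ [z3]"]) auto
    next
      assume "odd (length (rev (z3 # b)))"
      then show ?thesis using i h s by (intro exI[of _ "rev (z3 # b)"]) auto
    next
      assume "odd (length P)"
      then show ?thesis using P by blast
    qed
  next
    case False
    have disj: "u \<notin> set P" if "u \<in> set Q" for u
      using that False Q(6) bl Q' unfolding T_def by auto
    have Qadj: "A v u \<longleftrightarrow> v = q \<and> A q u" if "u \<in> set P" "v \<in> set Q" for u v
      using that Q(6) bl Q' unfolding T_def by auto
    have nbr: "\<exists>u\<in>set P. A q u" using Q(4) False unfolding q_def T_def by auto
    obtain a x c where x: "P = a @ x # c" "A q x" "\<forall>u\<in>set a. \<not> A q u"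
      using split_list_first_propE[OF nbr] by metis
    obtain d y e where y: "P = d @ y # e" "A q y" "\<forall>u\<in>set e. \<not> A q u"
      using split_list_last_propE[OF nbr] by metis
    let ?L13 = "(a @ [x]) @ rev Q" and ?L23 = "rev (y # e) @ rev Q"
    have Px: "P = (a @ [x]) @ c" using x(1) by simp
    have ia: "ind_path A (a @ [x])"
      using P(2) unfolding Px ind_path_append_iff[of A "a @ [x]"] by (elim conjE)
    have ie: "ind_path A (rev (y # e))"
      using P(2) unfolding y(1) ind_path_append_iff[of A d] ind_path_rev by (elim conjE)
    have sub: "set (a @ [x]) \<subseteq> set P" "set (rev (y # e)) \<subseteq> set P"
      unfolding Px by (simp, use y(1) Px in auto)
    have "ind_path A ?L13"
      unfolding ind_path_append_iff[of A "a @ [x]"]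
    proof (intro conjI ballI)
      show "set (a @ [x]) \<inter> set (rev Q) = {}" using sub disj by auto
      fix u v assume u: "u \<in> set (a @ [x])" and v: "v \<in> set (rev Q)"
      have "A u v \<longleftrightarrow> v = q \<and> A q u" using Qadj[of u v] u v sub sym_iff[of u v] by auto
      also have "\<dots> \<longleftrightarrow> u = last (a @ [x]) \<and> v = hd (rev Q)"
        using u x Q' by auto
      finally show "A u v \<longleftrightarrow> u = last (a @ [x]) \<and> v = hd (rev Q)" .
    qed (use ia Q ind_path_rev in auto)
    moreover have "hd ?L13 = z1" "last ?L13 = z3"
      using P(3) Q(1,3) x(1) by (auto simp: hd_append last_rev)
    moreover have "set ?L13 \<subseteq> Y" using sub P(5) Q(5) by auto
    ultimately have L13: "?thesis" if "odd (length ?L13)"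
      using that by (intro exI[of _ ?L13]) auto
    have "ind_path A ?L23"
      unfolding ind_path_append_iff[of A "rev (y # e)"]
    proof (intro conjI ballI)
      show "set (rev (y # e)) \<inter> set (rev Q) = {}" using sub disj by auto
      fix u v assume u: "u \<in> set (rev (y # e))" and v: "v \<in> set (rev Q)"
      have "A u v \<longleftrightarrow> v = q \<and> A q u" using Qadj[of u v] u v sub sym_iff[of u v] by auto
      also have "\<dots> \<longleftrightarrow> u = last (rev (y # e)) \<and> v = hd (rev Q)"
        using u y Q' by auto
      finally show "A u v \<longleftrightarrow> u = last (rev (y # e)) \<and> v = hd (rev Q)" .
    qed (use ie Q ind_path_rev in auto)
    moreover have "hd ?L23 = z2" "last ?L23 = z3"
      using P(4) Q(1,3) y(1) by (auto simp: hd_append hd_rev last_rev)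
    moreover have "set ?L23 \<subseteq> Y" using sub P(5) Q(5) by auto
    ultimately have L23: "?thesis" if "odd (length ?L23)"
      using that by (intro exI[of _ ?L23]) auto
    show ?thesis
    proof (cases "x = y")
      case True
      have "c = e" using distinct_split_unique[of a x c d e] x(1) y(1) True dP by simp
      \<comment> \<open>The three lengths have an odd sum: \<open>a\<close>, \<open>e\<close> and
        \<open>Q\<close> are counted twice each, and three units remain.\<close>
      then have "odd (length ?L13) \<or> odd (length ?L23) \<or> odd (length P)"
        using x(1) by auto
      then show ?thesis using L13 L23 P by blast
    next
      case False
      have "y \<in> set P" using y(1) by simp
      then have "y \<in> set c" using x y(2) False by auto
      then obtain f g where fg: "c = f @ y # g" by (meson split_list)
      have P': "P = (a @ x # f) @ y # g" using x(1) fg by simp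
      then have "g = e" using distinct_split_unique[of "a @ x # f" y g d e] y(1) dP by simp
      then have P'': "P = (a @ [x]) @ f @ y # e" using P' by simp
      \<comment> \<open>Otherwise \<open>q\<close>, \<open>x\<close>, \<open>y\<close> form a
        triangle. With \<open>f\<close> nonempty, the detour \<open>?L12\<close>, which replaces
        \<open>f\<close> by \<open>q\<close>, has no chord.\<close>
      have "f \<noteq> []"
      proof
        assume "f = []"
        then have "A x y" using P(2) unfolding P'' by (auto simp: ind_path_append_iff)
        then show False using tf x(2) y(2) sym by blast
      qed
      then have far: "\<not> A u v" if "u \<in> set (a @ [x])" "v \<in> set (y # e)" for u v
      proof -
        have "v \<noteq> hd (f @ y # e)" using dP \<open>f \<noteq> []\<close> that(2) unfolding P'' by (cases f) auto
        moreover have "\<forall>x'\<in>set (a @ [x]). \<forall>v\<in>set (f @ y # e). A x' v \<longleftrightarrow> x' = last (a @ [x]) \<and> v = hd (f @ y # e)"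
          using P(2) unfolding P'' ind_path_append_iff[of A "a @ [x]"] by (elim conjE)
        ultimately show ?thesis using that by auto
      qed
      have qn: "q \<notin> set P" using \<open>q \<notin> set P\<close> .
      let ?L12 = "(a @ [x]) @ q # y # e"
      have iq: "ind_path A (q # y # e)"
        using ie y qn by (auto simp: ind_path_rev simp del: rev.simps)
      have "ind_path A ?L12"
        unfolding ind_path_append_iff[of A "a @ [x]"]
      proof (intro conjI ballI)
        show "set (a @ [x]) \<inter> set (q # y # e) = {}" using qn dP unfolding P'' by auto
        fix u v assume u: "u \<in> set (a @ [x])" and v: "v \<in> set (q # y # e)"
        show "A u v \<longleftrightarrow> u = last (a @ [x]) \<and> v = hd (q # y # e)"
        proof (cases "v = q")
          case True
          then show ?thesis using u x sym_iff[of u q] by auto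
        next
          case False
          then show ?thesis using far[OF u, of v] v by auto
        qed
      qed (use ia iq in auto)
      moreover have "hd ?L12 = z1" "last ?L12 = z2"
        using P(3,4) unfolding P'' by (auto simp: hd_append)
      moreover have "set ?L12 \<subseteq> Y" using P(5) Q(1,5) unfolding P'' q_def by auto
      moreover have "odd (length ?L13) \<or> odd (length ?L23) \<or> odd (length ?L12)" by auto
      ultimately show ?thesis using L13 L23 by blast
    qed
  qed
qed

end

section \<open>Graphs of large girth\<close>

text \<open>The girth is only bounded below, since this form survives the deletion of vertices. No
  vertex set is carried along: deleted vertices become isolated, and finiteness concerns the
  others.\<close>

locale long_girth = sym_adj A for A :: "'a \<Rightarrow> 'a \<Rightarrow> bool" +
  fixes l :: nat
  assumes l_ge: "5 \<le> l"
    and girth: "cycle_in A c \<Longrightarrow> 2 * l \<le> length c"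
    and even_hole: "cycle_in A c \<Longrightarrow> chordless A c \<Longrightarrow> even (length c) \<Longrightarrow> length c = 2 * l"
    and finite_nonisolated: "finite {x. \<exists>y. A x y}"
begin

text \<open>From the point where the paths diverge up to their next meeting point they bound a
  cycle. Lengths count vertices, so the paths have \<open>length p + length q - 2\<close> edges in
  total, at least as many as this cycle.\<close>

lemma two_paths:
  assumes "path_in A p" "path_in A q" "hd p = hd q" "last p = last q" "p \<noteq> q"
  shows "2 * l + 2 \<le> length p + length q"
  using assms
proof (induction p arbitrary: q)
  case Nil
  then show ?case by (simp add: path_in_def)
next
  case (Cons u p')
  then obtain q' where q: "q = u # q'" by (cases q) (auto simp: path_in_def)
  have d: "u \<notin> set p'" "u \<notin> set q'" "distinct p'" "distinct q'" "successively A p'" "successively A q'"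
    using Cons.prems q by (auto simp: path_in_def successively_Cons)
  have ne: "p' \<noteq> []" "q' \<noteq> []"
    using Cons.prems(4,5) d(1,2) q by (auto split: if_splits)
  have adj: "A u (hd p')" "A u (hd q')" using Cons.prems(1,2) q ne by (auto simp: path_in_def successively_Cons)
  have l': "last p' = last q'" using Cons.prems(4) q ne by simp
  show ?case
  proof (cases "hd p' = hd q'")
    case True
    then have "2 * l + 2 \<le> length p' + length q'"
      using Cons.IH[of q'] d ne l' Cons.prems(5) q by (auto simp: path_in_def)
    then show ?thesis using q by simp
  next
    case False
    have "\<exists>x\<in>set p'. x \<in> set q'" using l' ne by (metis last_in_set)
    then obtain a x r where p: "p' = a @ x # r" "x \<in> set q'" "\<forall>y\<in>set a. y \<notin> set q'"
      using split_list_first_propE[of p' "\<lambda>x. x \<in> set q'"] by metis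
    then obtain b s where q': "q' = b @ x # s" by (meson split_list)
    have sa: "successively A (u # a @ [x])"
      using d adj unfolding p by (cases a) (auto simp: successively_Cons successively_append_iff hd_append split: if_splits)
    have sb: "successively A (u # b @ [x])"
      using d adj unfolding q' by (cases b) (auto simp: successively_Cons successively_append_iff hd_append split: if_splits)
    have "successively A (rev (b @ [x]))" using sb unfolding successively_rev by (cases b) (auto simp: successively_Cons)
    then have sb': "successively A (x # rev b)" by simp
    have "cycle_in A (u # a @ x # rev b)"
      unfolding cycle_in_def
    proof (intro conjI)
      show "3 \<le> length (u # a @ x # rev b)"
        using False p(1) q' by (cases a; cases b) auto
      show "distinct (u # a @ x # rev b)"
        using d p q' by auto
      have "successively A ((u # a @ [x]) @ rev b)"
        using sa sb' unfolding successively_append_iff[of A "u # a @ [x]"] by (auto simp: successively_Cons)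
      then show "successively A (u # a @ x # rev b)" by simp
      show "A (last (u # a @ x # rev b)) (hd (u # a @ x # rev b))"
        using sb sym by (cases b) (auto simp: successively_Cons)
    qed
    from girth[OF this] show ?thesis using p(1) q' q by simp
  qed
qed

lemma no_triangle: "A x y \<Longrightarrow> A y z \<Longrightarrow> A z x \<Longrightarrow> False"
  using girth[of "[x, y, z]"] l_ge neq by (auto simp: cycle_in_def)

lemma no_square: "A x y \<Longrightarrow> A y z \<Longrightarrow> A z u \<Longrightarrow> A u x \<Longrightarrow> x \<noteq> z \<Longrightarrow> y \<noteq> u \<Longrightarrow> False"
  using girth[of "[x, y, z, u]"] l_ge neq by (auto simp: cycle_in_def)

lemma no_pentagon:
  "A x y \<Longrightarrow> A y z \<Longrightarrow> A z u \<Longrightarrow> A u v \<Longrightarrow> A v x \<Longrightarrow> distinct [x, y, z, u, v] \<Longrightarrow> False"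
  using girth[of "[x, y, z, u, v]"] l_ge by (auto simp: cycle_in_def)

text \<open>A chord splits a cycle of length \<open>n\<close> into two cycles of total length \<open>n + 2\<close>.\<close>

lemma short_even_cycle:
  assumes c: "cycle_in A c" and ev: "even (length c)" and short: "length c + 2 < 4 * l"
  shows "length c = 2 * l"
proof (rule even_hole[OF c _ ev], unfold chordless_def, intro allI impI)
  fix i j assume ij: "i < j" "j < length c" "A (c ! i) (c ! j)"
  have d: "distinct c" and s: "successively A c" and e: "A (last c) (hd c)" and ne: "c \<noteq> []"
    using c by (auto simp: cycle_in_def)
  have s': "A (c ! k) (c ! Suc k)" if "Suc k < length c" for k
    using s that by (simp add: successively_conv_nth)
  have sn: "c ! i \<noteq> c ! j" using d ij by (simp add: nth_eq_iff_index_eq)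
  have short_path: "path_in A [c ! i, c ! j]" using ij sn by (simp add: path_in_def)
  show "j = Suc i \<or> i = 0 \<and> Suc j = length c"
  proof (rule ccontr)
    assume n: "\<not> ?thesis"
    \<comment> \<open>The two arcs of the cycle between the ends of the chord; \<open>?r\<close>
      passes through the closing edge.\<close>
    let ?q = "take (Suc (j - i)) (drop i c)"
    let ?r = "rev (take (Suc i) c) @ rev (drop j c)"
    have lq: "length ?q = Suc (j - i)" using ij by simp
    have "path_in A ?q"
      unfolding path_in_def successively_conv_nth using ij d s' ne by auto
    moreover have "hd ?q = c ! i" using ij by (simp add: hd_drop_conv_nth)
    moreover have "last ?q = c ! j" using ij lq last_conv_nth[of ?q] by auto
    moreover have "?q \<noteq> [c ! i, c ! j]" using lq n ij by (metis length_Cons list.size(3) Suc_inject add_diff_inverse_nat less_imp_not_less add_Suc_right add_0_right One_nat_def)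
    ultimately have 1: "2 * l + 2 \<le> 2 + Suc (j - i)"
      using two_paths[OF short_path, of ?q] lq by auto
    have lr: "length ?r = Suc i + (length c - j)" using ij by simp
    have "distinct ?r"
      using d ij set_take_disj_set_drop_if_distinct[OF d, of "Suc i" j] by auto
    moreover have "successively A ?r"
      unfolding successively_append_iff successively_rev
    proof (intro conjI disjI2)
      show "successively A (take (Suc i) c)" "successively A (drop j c)"
        using s' by (auto simp: successively_conv_nth)
      show "A (last (rev (take (Suc i) c))) (hd (rev (drop j c)))"
        using e sym ij ne by (auto simp: last_rev hd_rev)
    qed
    ultimately have "path_in A ?r" using ij ne by (auto simp: path_in_def)
    moreover have "hd ?r = c ! i" using ij by (simp add: hd_append hd_rev take_Suc_conv_app_nth)
    moreover have "last ?r = c ! j" using ij by (simp add: last_rev hd_drop_conv_nth)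
    moreover have "?r \<noteq> [c ! i, c ! j]"
    proof
      assume "?r = [c ! i, c ! j]"
      then have "length ?r = 2" by simp
      then show False using lr n ij by auto
    qed
    ultimately have 2: "2 * l + 2 \<le> 2 + (Suc i + (length c - j))"
      using two_paths[OF short_path, of ?r] lr by auto
    \<comment> \<open>Together the arcs have \<open>length c + 2\<close> vertices, and each has at
      least \<open>2 * l\<close>.\<close>
    show False using 1 2 ij short by linarith
  qed
qed

end

section \<open>Cycles of length \<open>2l\<close> through a vertex\<close>

lemma path_in_appendD:
  assumes "path_in A (p @ q)"
  shows "p \<noteq> [] \<Longrightarrow> path_in A p" "q \<noteq> [] \<Longrightarrow> path_in A q"
  using assms by (auto simp: path_in_def successively_append_iff)

context sym_adj begin

lemma cycle_in_rev: "cycle_in A (w # p) \<Longrightarrow> cycle_in A (w # rev p)"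
  using successively_rev[of p] sym
  by (cases "p = []") (auto simp: cycle_in_def successively_Cons last_rev hd_rev)

lemma cycle_in_flip: "cycle_in A (u # v # p) \<Longrightarrow> cycle_in A (v # u # rev p)"
  using successively_rev[of p] sym
  by (cases "p = []") (auto simp: cycle_in_def successively_Cons last_rev hd_rev)

lemma cycle_in_Cons_path:
  "cycle_in A (w # p) \<Longrightarrow> path_in A p"
  by (cases "p = []") (auto simp: cycle_in_def path_in_def successively_Cons)

text \<open>If both interiors were empty, the two paths would be the same edge and enclose
  nothing.\<close>

lemma path_in_glue:
  assumes "path_in A (u # p @ [v])" "path_in A (u # q @ [v])" "set p \<inter> set q = {}" "p \<noteq> [] \<or> q \<noteq> []"
  shows "cycle_in A (u # p @ v # rev q)"
proof -
  have "successively A (rev (q @ [v]))"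
    using assms(2) unfolding successively_rev path_in_def by (cases q) (auto simp: successively_Cons)
  then have "successively A ((u # p @ [v]) @ rev q)"
    using assms(1) unfolding successively_append_iff[of A "u # p @ [v]"] path_in_def
    by (auto simp: successively_Cons)
  then have s: "successively A (u # p @ v # rev q)" by simp
  have "A (last (u # p @ v # rev q)) u"
    using assms(2) sym by (cases q) (auto simp: path_in_def successively_Cons)
  then show ?thesis
    using assms s by (cases p; cases q) (auto simp: cycle_in_def path_in_def)
qed

end

context long_girth begin

text \<open>The path \<open>z y w y' z'\<close> extends to a cycle of length \<open>2 * l\<close>;
  its five vertices leave \<open>2 * l - 5\<close> for \<open>m\<close>.\<close>

definition linked :: "'a \<Rightarrow> 'a \<Rightarrow> 'a \<Rightarrow> 'a \<Rightarrow> 'a \<Rightarrow> bool" where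
  "linked w y z y' z' \<longleftrightarrow> (\<exists>m. length m = 2 * l - 5 \<and> cycle_in A (w # y # z # m @ [z', y']))"

lemma linked_sym:
  assumes "linked w y z y' z'"
  shows "linked w y' z' y z"
proof -
  obtain m where m: "length m = 2 * l - 5" "cycle_in A (w # y # z # m @ [z', y'])"
    using assms unfolding linked_def by blast
  show ?thesis unfolding linked_def using cycle_in_rev[OF m(2)] m(1)
    by (intro exI[of _ "rev m"]) simp
qed

text \<open>If the two cycles share only \<open>y w y'\<close>, dropping \<open>w\<close> leaves an
  even cycle of length \<open>4 * l - 4\<close>, short enough for \<open>short_even_cycle\<close>
  but different from \<open>2 * l\<close>. If they meet again at \<open>x\<close>, then
  \<open>two_paths\<close> on both sides of \<open>x\<close> needs more vertices than there
  are.\<close>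

lemma linked_disjoint:
  assumes "linked w y z y' b" "linked w y z' y' b'" "z \<noteq> z'" "b \<noteq> b'"
  shows False
proof -
  obtain m where m: "length m = 2 * l - 5" "cycle_in A (w # y # z # m @ [b, y'])"
    using assms unfolding linked_def by blast
  obtain m' where m': "length m' = 2 * l - 5" "cycle_in A (w # y # z' # m' @ [b', y'])"
    using assms unfolding linked_def by blast
  define s s' where "s = z # m @ [b]" and "s' = z' # m' @ [b']"
  have ls: "length s = 2 * l - 3" "length s' = 2 * l - 3" using m(1) m'(1) l_ge unfolding s_def s'_def by auto
  have p: "path_in A (y # s @ [y'])" "path_in A (y # s' @ [y'])"
    using cycle_in_Cons_path[OF m(2)] cycle_in_Cons_path[OF m'(2)] unfolding s_def s'_def by auto
  show False
  proof (cases "set s \<inter> set s' = {}")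
    case True
    have "cycle_in A (y # s @ y' # rev s')"
      using path_in_glue[OF p True] unfolding s_def by blast
    moreover have "length (y # s @ y' # rev s') = 4 * l - 4" using ls l_ge by simp
    moreover have "even (4 * l - 4)" by simp
    ultimately have "4 * l - 4 = 2 * l"
      using short_even_cycle[of "y # s @ y' # rev s'"] l_ge by simp
    then show False using l_ge by linarith
  next
    case False
    then obtain x where "x \<in> set s" "x \<in> set s'" by blast
    then obtain s1 s2 s1' s2' where x: "s = s1 @ x # s2" "s' = s1' @ x # s2'" by (meson split_list)
    have "path_in A ((y # s1 @ [x]) @ s2 @ [y'])" "path_in A ((y # s1' @ [x]) @ s2' @ [y'])"
      "path_in A ((y # s1) @ x # s2 @ [y'])" "path_in A ((y # s1') @ x # s2' @ [y'])"
      using p unfolding x by auto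
    then have q: "path_in A (y # s1 @ [x])" "path_in A (y # s1' @ [x])"
      "path_in A (x # s2 @ [y'])" "path_in A (x # s2' @ [y'])"
      by - (erule path_in_appendD, simp)+
    have "hd (s1 @ [x]) = z" "hd (s1' @ [x]) = z'"
      using x unfolding s_def s'_def by (cases s1, auto, cases s1', auto)
    then have "s1 @ [x] \<noteq> s1' @ [x]" using assms(3) by metis
    then have 1: "2 * l + 2 \<le> length s1 + length s1' + 4"
      using two_paths[OF q(1,2)] by auto
    have "last (x # s2) = b" "last (x # s2') = b'"
      using x unfolding s_def s'_def by (metis last_appendR last_snoc list.distinct(1) append_Cons)+
    then have "s2 @ [y'] \<noteq> s2' @ [y']" using assms(4) by auto
    then have 2: "2 * l + 2 \<le> length s2 + length s2' + 4"
      using two_paths[OF q(3,4)] by auto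
    show False using 1 2 ls l_ge x by simp
  qed
qed

text \<open>Follow both cycles from \<open>y'\<close> through \<open>b\<close> and \<open>b'\<close>
  to their first common vertex \<open>x\<close>. Beyond \<open>x\<close> they coincide, and before
  it they enclose a cycle of length \<open>2 * l\<close>. So \<open>y'\<close> and \<open>x\<close>
  are joined by three paths of length \<open>l\<close>, any two of which form a cycle of length
  \<open>2 * l\<close>.\<close>

lemma linked_fork:
  assumes "linked w y a y' b" "linked w y a y' b'" "b \<noteq> b'"
  shows "\<exists>c c'. linked y' w y b c \<and> linked y' w y b' c' \<and> linked y' b c b' c'"
proof -
  obtain m where m: "length m = 2 * l - 5" "cycle_in A (w # y' # b # m @ [a, y])"
    using linked_sym[OF assms(1)] unfolding linked_def by blast
  obtain m' where m': "length m' = 2 * l - 5" "cycle_in A (w # y' # b' # m' @ [a, y])"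
    using linked_sym[OF assms(2)] unfolding linked_def by blast
  define s s' where "s = b # m @ [a]" and "s' = b' # m' @ [a]"
  have ls: "length s = 2 * l - 3" "length s' = 2 * l - 3" using m(1) m'(1) l_ge unfolding s_def s'_def by auto
  have p: "path_in A (y' # s @ [y])" "path_in A (y' # s' @ [y])"
    using cycle_in_Cons_path[OF m(2)] cycle_in_Cons_path[OF m'(2)] unfolding s_def s'_def by auto
  have "\<exists>x\<in>set s. x \<in> set s'" unfolding s_def s'_def by auto
  then obtain s1 x r where x: "s = s1 @ x # r" "x \<in> set s'" "\<forall>u\<in>set s1. u \<notin> set s'"
    using split_list_first_propE[of s "\<lambda>x. x \<in> set s'"] by metis
  then obtain s1' r' where x': "s' = s1' @ x # r'" by (meson split_list)
  have "path_in A ((y' # s1 @ [x]) @ r @ [y])" "path_in A ((y' # s1' @ [x]) @ r' @ [y])"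
    "path_in A ((y' # s1) @ x # r @ [y])" "path_in A ((y' # s1') @ x # r' @ [y])"
    using p unfolding x x' by auto
  then have q: "path_in A (y' # s1 @ [x])" "path_in A (y' # s1' @ [x])"
    "path_in A (x # r @ [y])" "path_in A (x # r' @ [y])"
    by - (erule path_in_appendD, simp)+
  have hds: "hd (s1 @ [x]) = b" "hd (s1' @ [x]) = b'"
    using x x' unfolding s_def s'_def by (cases s1, auto, cases s1', auto)
  have ne: "s1 \<noteq> [] \<or> s1' \<noteq> []" using hds assms(3) by auto
  have cyc: "cycle_in A (y' # s1 @ x # rev s1')"
    using path_in_glue[OF q(1,2) _ ne] x(3) x' by auto
  \<comment> \<open>Otherwise \<open>two_paths\<close> beyond \<open>x\<close> and the girth bound
    for \<open>cyc\<close> together exceed the total length of \<open>s\<close> and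
    \<open>s'\<close>.\<close>
  have r: "r = r'"
  proof (rule ccontr)
    assume "r \<noteq> r'"
    then have "2 * l + 2 \<le> length r + length r' + 4" using two_paths[OF q(3,4)] by auto
    then show False using girth[OF cyc] ls x x' l_ge by simp
  qed
  then have l1: "length s1 = length s1'" using ls x x' by simp
  have lc: "length (y' # s1 @ x # rev s1') = 2 * length s1 + 2" using l1 by simp
  have "length s1 \<le> 2 * l - 4" using ls x by simp
  then have "2 * length s1 + 2 = 2 * l"
    using short_even_cycle[OF cyc] l_ge unfolding lc by auto
  then have "length s1 = l - 1" by simp
  then have len: "length s1 = l - 1" "length s1' = l - 1" using l1 by auto
  obtain c t where t: "s1 = b # c # t" using len(1) hds(1) l_ge
    by (cases s1; cases "tl s1") auto
  obtain c' t' where t': "s1' = b' # c' # t'" using len(2) hds(2) l_ge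
    by (cases s1'; cases "tl s1'") auto
  have "linked y' b c b' c'"
    unfolding linked_def using cyc len t t' l_ge
    by (intro exI[of _ "t @ x # rev t'"]) auto
  moreover have "linked y' w y b c"
    unfolding linked_def
  proof (intro exI conjI)
    have "w # y' # b # m @ [a, y] = w # y' # b # c # t @ x # r @ [y]"
      using x(1) t unfolding s_def by simp
    then have "cycle_in A (w # y' # b # c # t @ x # r @ [y])" using m(2) by (simp only:)
    from cycle_in_flip[OF this]
    show "cycle_in A (y' # w # y # rev (t @ x # r) @ [c, b])" by simp
    show "length (rev (t @ x # r)) = 2 * l - 5" using ls x t by simp
  qed
  moreover have "linked y' w y b' c'"
    unfolding linked_def
  proof (intro exI conjI)
    have "w # y' # b' # m' @ [a, y] = w # y' # b' # c' # t' @ x # r' @ [y]"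
      using x' t' unfolding s'_def by simp
    then have "cycle_in A (w # y' # b' # c' # t' @ x # r' @ [y])" using m'(2) by (simp only:)
    from cycle_in_flip[OF this]
    show "cycle_in A (y' # w # y # rev (t' @ x # r') @ [c', b'])" by simp
    show "length (rev (t' @ x # r')) = 2 * l - 5" using ls x' t' by simp
  qed
  ultimately show ?thesis by blast
qed

text \<open>The vertices \<open>r\<close>, \<open>y\<close>, \<open>y'\<close> close
  \<open>p\<close> to a chordless cycle with \<open>length p + 3\<close> vertices. This number is
  even, hence \<open>2 * l\<close>.\<close>

lemma linkedI:
  assumes "A r y" "A r y'" "y \<noteq> y'" "p \<noteq> []" "ind_path A p" "hd p = z" "last p = z'" "odd (length p)"
    and far: "\<And>u. u \<in> set p \<Longrightarrow> u \<noteq> r \<and> u \<noteq> y \<and> u \<noteq> y' \<and> \<not> A r u"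
    and adj: "\<And>u. u \<in> set p \<Longrightarrow> A y u \<longleftrightarrow> u = z" "\<And>u. u \<in> set p \<Longrightarrow> A y' u \<longleftrightarrow> u = z'"
  shows "linked r y z y' z'"
proof -
  have nA: "\<not> A y y'" using no_triangle assms(1,2) sym by blast
  have "ind_path A (p @ [y'])"
    unfolding ind_path_append_iff using assms sym_iff by auto
  then have i: "ind_path A (y # p @ [y'])"
    using assms nA far adj by auto
  have "\<forall>u\<in>set (y # p @ [y']). A r u \<longleftrightarrow> u = hd (y # p @ [y']) \<or> u = last (y # p @ [y'])"
    using assms(1,2) far by auto
  moreover have "r \<notin> set (y # p @ [y'])" using assms(1,2) far neq by auto
  ultimately have c: "cycle_in A (r # y # p @ [y'])" "chordless A (r # y # p @ [y'])"
    using closing_vertex_hole[OF i, of r] by auto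
  have lp: "length p + 3 = 2 * l" using even_hole[OF c] assms(8) by simp
  obtain p' where p': "p = z # p'" using assms(4,6) by (cases p) auto
  have "p' \<noteq> []" using lp p' l_ge by auto
  then obtain m where "p' = m @ [z']" using assms(7) p' by (metis append_butlast_last_id last.simps)
  then have "p = z # m @ [z']" using p' by simp
  then show ?thesis unfolding linked_def using c(1) lp by (intro exI[of _ m]) auto
qed

text \<open>Applies \<open>even_ind_path\<close> inside \<open>X\<close> together with
  \<open>z1\<close>, \<open>z2\<close>, \<open>z3\<close>. Without squares, \<open>z1\<close> is the
  only vertex there adjacent to \<open>y1\<close>, and likewise for the others, as
  \<open>linkedI\<close> demands.\<close>

lemma linked_of_connected:
  assumes r: "A r y1" "A r y2" "A r y3" and y: "y1 \<noteq> y2" "y1 \<noteq> y3" "y2 \<noteq> y3"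
    and z: "A y1 z1" "A y2 z2" "A y3 z3" "z1 \<noteq> r" "z2 \<noteq> r" "z3 \<noteq> r"
    and con: "\<And>u v. u \<in> X \<Longrightarrow> v \<in> X \<Longrightarrow> (\<lambda>a b. A a b \<and> a \<in> X \<and> b \<in> X)\<^sup>*\<^sup>* u v"
    and far: "\<And>u v. u \<in> X \<Longrightarrow> v \<in> {r, y1, y2, y3} \<Longrightarrow> u \<noteq> v \<and> \<not> A v u"
    and att: "\<exists>u\<in>X. A z1 u" "\<exists>u\<in>X. A z2 u" "\<exists>u\<in>X. A z3 u"
  shows "linked r y1 z1 y2 z2 \<or> linked r y1 z1 y3 z3 \<or> linked r y2 z2 y3 z3"
proof -
  define Y where "Y = X \<union> {z1, z2, z3}"
  let ?R = "\<lambda>a b. A a b \<and> a \<in> Y \<and> b \<in> Y"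
  have conY: "?R\<^sup>*\<^sup>* u v" if "u \<in> X" "v \<in> X" for u v
    using con[OF that] by (rule rtranclp_mono[THEN predicate2D, rotated]) (auto simp: Y_def)
  have link: "?R\<^sup>*\<^sup>* z z'" if "z \<in> {z1, z2, z3}" "z' \<in> {z1, z2, z3}" for z z'
  proof -
    obtain u v where uv: "u \<in> X" "A z u" "v \<in> X" "A z' v" using att \<open>z \<in> _\<close> \<open>z' \<in> _\<close> by blast
    then have "?R z u" "?R v z'" using that sym by (auto simp: Y_def)
    have "?R\<^sup>*\<^sup>* z v" by (rule converse_rtranclp_into_rtranclp[OF \<open>?R z u\<close> conY[OF uv(1,3)]])
    then show ?thesis using \<open>?R v z'\<close> by (rule rtranclp.rtrancl_into_rtrancl)
  qed
  have rz: "\<not> A r z1" "\<not> A r z2" "\<not> A r z3" using no_triangle r z sym by blast+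
  have cross: "\<not> A y z" if "A r y" "A r y'" "A y' z" "z \<noteq> r" "y \<noteq> y'" for y y' z
    using no_square[of r y z y'] that sym by blast
  have yz: "y \<noteq> z" if "A r y" "A r y'" "A y' z" for y y' z
    using no_triangle that sym by blast
  have farY: "u \<noteq> r \<and> u \<noteq> y1 \<and> u \<noteq> y2 \<and> u \<noteq> y3 \<and> \<not> A r u" if "u \<in> Y" for u
    using that far z r rz yz unfolding Y_def by (metis Un_iff insertCI insertE singletonD)
  have adjY: "A y1 u \<longleftrightarrow> u = z1" "A y2 u \<longleftrightarrow> u = z2" "A y3 u \<longleftrightarrow> u = z3" if "u \<in> Y" for u
    using that far z r y cross unfolding Y_def by (metis Un_iff insertCI insertE singletonD)+
  obtain p where p: "p \<noteq> []" "ind_path A p" "set p \<subseteq> Y" "odd (length p)"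
    "hd p = z1 \<and> last p = z2 \<or> hd p = z1 \<and> last p = z3 \<or> hd p = z2 \<and> last p = z3"
    using even_ind_path[of Y z1 z2 z3] no_triangle link by (auto simp: Y_def)
  have *: "linked r y z y' z'"
    if "A r y" "A r y'" "y \<noteq> y'" "hd p = z" "last p = z'" "y \<in> {y1, y2, y3}" "y' \<in> {y1, y2, y3}"
      "\<And>u. u \<in> Y \<Longrightarrow> A y u \<longleftrightarrow> u = z" "\<And>u. u \<in> Y \<Longrightarrow> A y' u \<longleftrightarrow> u = z'" for y z y' z'
    by (rule linkedI[OF that(1-3) p(1,2) that(4,5) p(4)]) (use that p(3) farY in blast)+
  from p(5) show ?thesis
  proof (elim disjE conjE)
    assume "hd p = z1" "last p = z2"
    then show ?thesis using *[of y1 y2 z1 z2] r y adjY by simp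
  next
    assume "hd p = z1" "last p = z3"
    then show ?thesis using *[of y1 y3 z1 z3] r y adjY by simp
  next
    assume "hd p = z2" "last p = z3"
    then show ?thesis using *[of y2 y3 z2 z3] r y adjY by simp
  qed
qed

end

section \<open>Components after removing a star\<close>

context sym_adj begin

definition nbhd :: "'a set \<Rightarrow> 'a set" where
  "nbhd K = K \<union> {y. \<exists>k\<in>K. A k y}"

definition star :: "'a \<Rightarrow> 'a set \<Rightarrow> bool" where
  "star v K \<longleftrightarrow> v \<in> K \<and> (\<forall>k\<in>K. k = v \<or> A v k)"

abbreviation adj_within :: "'a set \<Rightarrow> 'a \<Rightarrow> 'a \<Rightarrow> bool" where
  "adj_within S \<equiv> \<lambda>a b. A a b \<and> a \<in> S \<and> b \<in> S"

text \<open>A start \<open>x\<close> outside \<open>S\<close> is allowed and yields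
  \<open>{x}\<close>; hence the condition \<open>x \<in> S\<close> in
  \<open>component_subset\<close>.\<close>

definition component :: "'a set \<Rightarrow> 'a \<Rightarrow> 'a set" where
  "component S x = {y. (adj_within S)\<^sup>*\<^sup>* x y}"

primrec ball :: "'a \<Rightarrow> nat \<Rightarrow> 'a set" where
  "ball v 0 = {v}"
| "ball v (Suc n) = nbhd (ball v n)"

lemma component_self: "x \<in> component S x"
  by (simp add: component_def)

lemma component_step: "y \<in> component S x \<Longrightarrow> A y z \<Longrightarrow> y \<in> S \<Longrightarrow> z \<in> S \<Longrightarrow> z \<in> component S x"
  unfolding component_def by (simp add: rtranclp.rtrancl_into_rtrancl)

lemma adj_within_sym: "(adj_within S)\<^sup>*\<^sup>* x y \<Longrightarrow> (adj_within S)\<^sup>*\<^sup>* y x"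
  by (rule sympD[OF symp_rtranclp]) (auto intro!: sympI sym)

lemma component_sym: "y \<in> component S x \<Longrightarrow> x \<in> component S y"
  unfolding component_def using adj_within_sym by simp

lemma component_trans: "y \<in> component S x \<Longrightarrow> z \<in> component S y \<Longrightarrow> z \<in> component S x"
  unfolding component_def by simp

lemma component_subset:
  assumes "x \<in> S"
  shows "component S x \<subseteq> S"
proof
  fix y assume "y \<in> component S x"
  then have "(adj_within S)\<^sup>*\<^sup>* x y" by (simp add: component_def)
  then show "y \<in> S" using assms by (induction rule: rtranclp_induct) auto
qed

lemma component_connected_from: "y \<in> component S x \<Longrightarrow> (adj_within (component S x))\<^sup>*\<^sup>* x y"
proof -
  assume "y \<in> component S x"
  then have "(adj_within S)\<^sup>*\<^sup>* x y" by (simp add: component_def)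
  then show ?thesis
  proof (induction rule: rtranclp_induct)
    case (step y z)
    then have "y \<in> component S x" by (simp add: component_def)
    moreover from this have "z \<in> component S x" using step component_step by blast
    ultimately have "adj_within (component S x) y z" using step by blast
    with step.IH show ?case by (rule rtranclp.rtrancl_into_rtrancl)
  qed simp
qed

lemma component_connected:
  assumes "y \<in> component S x" "z \<in> component S x"
  shows "(adj_within (component S x))\<^sup>*\<^sup>* y z"
  using rtranclp_trans[OF adj_within_sym[OF component_connected_from[OF assms(1)]]
      component_connected_from[OF assms(2)]] .

text \<open>A walk within the component stays in \<open>T\<close> even if \<open>S\<close> does not.
  This compares components left by the removal of different stars.\<close>

lemma component_mono:
  assumes "component S x \<subseteq> T"
  shows "component S x \<subseteq> component T x"
proof
  fix y assume "y \<in> component S x"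
  then have "(adj_within (component S x))\<^sup>*\<^sup>* x y" by (rule component_connected_from)
  then have "(adj_within T)\<^sup>*\<^sup>* x y"
    by (rule rtranclp_mono[THEN predicate2D, rotated]) (use assms in auto)
  then show "y \<in> component T x" by (simp add: component_def)
qed

lemma component_nonisolated:
  assumes "y \<in> component S x" "\<exists>z. A x z"
  shows "\<exists>z. A y z"
proof -
  have "(adj_within S)\<^sup>*\<^sup>* x y" using assms(1) by (simp add: component_def)
  then show ?thesis using assms(2) by (induction rule: rtranclp_induct) (auto intro: sym)
qed

lemma ball_mono: "m \<le> n \<Longrightarrow> ball v m \<subseteq> ball v n"
  by (rule lift_Suc_mono_le[of "ball v"]) (auto simp: nbhd_def)

lemma ball_step: "y \<in> ball v n \<Longrightarrow> A y x \<Longrightarrow> x \<in> ball v (Suc n)"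
  by (auto simp: nbhd_def)

lemma star_nbhd_subset_ball: "star v K \<Longrightarrow> nbhd K \<subseteq> ball v 2"
  by (auto simp: star_def nbhd_def numeral_2_eq_2)

lemma path_in_snoc:
  "path_in A p \<Longrightarrow> A (last p) x \<Longrightarrow> x \<notin> set p \<Longrightarrow> path_in A (p @ [x])"
  by (auto simp: path_in_def successively_append_iff)

text \<open>Grown layer by layer. The clause on \<open>butlast p\<close> later certifies that a
  vertex further out is not yet on the path; for \<open>n = 0\<close> it is vacuous.\<close>

lemma ball_path:
  assumes "x \<in> ball v n"
  shows "\<exists>p. path_in A p \<and> hd p = v \<and> last p = x \<and> length p \<le> Suc n \<and> set (butlast p) \<subseteq> ball v (n - 1)"
  using assms
proof (induction n arbitrary: x)
  case 0
  then show ?case by (intro exI[of _ "[v]"]) (auto simp: path_in_def)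
next
  case (Suc n)
  show ?case
  proof (cases "x \<in> ball v n")
    case True
    then show ?thesis using Suc.IH[OF True] ball_mono[of "n - 1" n v] by fastforce
  next
    case False
    then obtain y where y: "y \<in> ball v n" "A y x" using Suc.prems by (auto simp: nbhd_def)
    then obtain p where p: "path_in A p" "hd p = v" "last p = y" "length p \<le> Suc n"
      "set (butlast p) \<subseteq> ball v (n - 1)" using Suc.IH by blast
    have ne: "p \<noteq> []" using p(1) by (simp add: path_in_def)
    then have "set p = insert y (set (butlast p))"
      using p(3) by (metis append_butlast_last_id list.simps(15) rotate1.simps(2) set_rotate1)
    then have "set p \<subseteq> ball v n" using y p(5) ball_mono[of "n - 1" n v] by auto
    then show ?thesis using p y False ne path_in_snoc[OF p(1), of x]
      by (intro exI[of _ "p @ [x]"]) auto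
  qed
qed

end

section \<open>Graphs of minimum degree three and their least fragments\<close>

locale min_degree3 = long_girth +
  assumes deg: "A x y \<Longrightarrow> \<exists>z. A x z \<and> z \<noteq> a \<and> z \<noteq> b"
begin

text \<open>The start \<open>u\<close> must have a neighbour; otherwise any isolated element of the
  type would count as a component of size one.\<close>

definition fragment :: "'a \<Rightarrow> 'a set \<Rightarrow> 'a set \<Rightarrow> bool" where
  "fragment v K B \<longleftrightarrow> star v K \<and> (\<exists>u. u \<notin> nbhd K \<and> (\<exists>y. A u y) \<and> B = component (- nbhd K) u)"

lemma fragmentD:
  assumes "fragment v K B"
  shows "star v K" "B \<noteq> {}" "finite B" "B \<inter> nbhd K = {}"
    "\<And>x. x \<in> B \<Longrightarrow> \<exists>y. A x y" "\<And>x. x \<in> B \<Longrightarrow> B = component (- nbhd K) x"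
    "\<And>x y. x \<in> B \<Longrightarrow> A x y \<Longrightarrow> y \<notin> nbhd K \<Longrightarrow> y \<in> B"
proof -
  obtain u where u: "u \<notin> nbhd K" "\<exists>y. A u y" and B: "B = component (- nbhd K) u"
    using assms unfolding fragment_def by blast
  show "star v K" using assms unfolding fragment_def by blast
  show "B \<noteq> {}" using component_self B by blast
  show D: "B \<inter> nbhd K = {}" using component_subset[of u "- nbhd K"] u(1) B by auto
  show ni: "\<exists>y. A x y" if "x \<in> B" for x using component_nonisolated that u(2) B by blast
  show "finite B" by (rule finite_subset[OF _ finite_nonisolated]) (use ni in auto)
  show "B = component (- nbhd K) x" if "x \<in> B" for x
    using component_sym component_trans that B by blast
  show "y \<in> B" if "x \<in> B" "A x y" "y \<notin> nbhd K" for x y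
    using component_step[of x "- nbhd K" u y] that D B by auto
qed

text \<open>Otherwise let \<open>b\<close> be a vertex of \<open>B\<close> furthest from
  \<open>v\<close>, at distance \<open>n <= 4\<close>. No neighbour of \<open>b\<close> is further
  away, so one nearer neighbour and one other give distinct paths from \<open>v\<close> to
  \<open>b\<close> with at most 11 vertices in total. But \<open>2 * l + 2\<close> is at least
  12.\<close>

lemma fragment_deep:
  assumes B: "fragment v K B"
  shows "\<exists>w\<in>B. w \<notin> ball v 4"
proof (rule ccontr)
  assume "\<not> ?thesis"
  then have B4: "B \<subseteq> ball v 4" by blast
  note F = fragmentD[OF B]
  define lev where "lev x = (LEAST n. x \<in> ball v n)" for x
  have lev: "x \<in> ball v (lev x)" "lev x \<le> 4" if "x \<in> B" for x
    using that B4 LeastI[of "\<lambda>n. x \<in> ball v n" 4] Least_le[of "\<lambda>n. x \<in> ball v n" 4]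
    unfolding lev_def by auto
  obtain x0 where x0: "x0 \<in> B" using F(2) by blast
  have "\<exists>b. b \<in> B \<and> (\<forall>x. x \<in> B \<longrightarrow> lev x \<le> lev b)"
    by (rule ex_has_greatest_nat[where P = "\<lambda>x. x \<in> B" and k = x0 and b = 5])
      (use x0 lev(2) in fastforce)+
  then obtain b where b: "b \<in> B" "\<And>x. x \<in> B \<Longrightarrow> lev x \<le> lev b" by blast
  define n where "n = lev b"
  have K: "nbhd K \<subseteq> ball v 2" using star_nbhd_subset_ball F(1) by blast
  have "v \<in> K" using F(1) by (simp add: star_def)
  then have "ball v 1 \<subseteq> nbhd K" by (auto simp: nbhd_def)
  \<comment> \<open>So \<open>n\<close> is at least 2, and neighbours of \<open>b\<close> in
    \<open>nbhd K\<close> are no further from \<open>v\<close> than \<open>b\<close>.\<close>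
  then have "b \<notin> ball v 1" using F(4) b(1) by blast
  then have n2: "2 \<le> n" using lev[OF b(1)] ball_mono[of n 1 v] unfolding n_def
    by (metis One_nat_def Suc_1 not_less_eq_eq subsetD)
  then obtain m where m: "n = Suc m" by (cases n) auto
  have bn: "b \<in> ball v n" "n \<le> 4" using lev b(1) n_def by auto
  have bm: "b \<notin> ball v m" using not_less_Least[of m "\<lambda>n. b \<in> ball v n"] m unfolding n_def lev_def by simp
  have nbr: "x \<in> ball v n" if "A b x" for x
  proof (cases "x \<in> nbhd K")
    case True
    then show ?thesis using K ball_mono[OF n2, of v] by blast
  next
    case False
    then have "x \<in> B" using F(7) b(1) that by blast
    then show ?thesis using lev(1) b(2) ball_mono[of "lev x" n v] unfolding n_def by blast
  qed
  obtain y where y: "y \<in> ball v m" "A y b" using bn(1) bm m by (auto simp: nbhd_def)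
  obtain x where x: "A b x" "x \<noteq> y" using deg[OF sym[OF y(2)]] by blast
  obtain p where p: "path_in A p" "hd p = v" "last p = y" "length p \<le> Suc m"
    "set (butlast p) \<subseteq> ball v (m - 1)" using ball_path[OF y(1)] by blast
  obtain q where q: "path_in A q" "hd q = v" "last q = x" "length q \<le> Suc n"
    "set (butlast q) \<subseteq> ball v m" using ball_path[OF nbr[OF x(1)]] m by auto
  have ne: "p \<noteq> []" "q \<noteq> []" using p(1) q(1) by (auto simp: path_in_def)
  have sp: "set p = insert y (set (butlast p))" "set q = insert x (set (butlast q))"
    using p(3) q(3) ne by (metis append_butlast_last_id list.simps(15) rotate1.simps(2) set_rotate1)+
  have "b \<notin> set p" "b \<notin> set q"
    using sp p(5) q(5) bm y x neq ball_mono[of "m - 1" m v] by auto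
  then have "path_in A (p @ [b])" "path_in A (q @ [b])"
    using path_in_snoc p q y x sym by auto
  moreover have "p @ [b] \<noteq> q @ [b]" using p(3) q(3) x(2) by auto
  ultimately have "2 * l + 2 \<le> length (p @ [b]) + length (q @ [b])"
    using two_paths[of "p @ [b]" "q @ [b]"] p(2) q(2) ne by auto
  then show False using p(4) q(4) bn(2) m l_ge by simp
qed

definition least_fragment :: "'a \<Rightarrow> 'a set \<Rightarrow> 'a set \<Rightarrow> bool" where
  "least_fragment v K B \<longleftrightarrow> fragment v K B \<and> (\<forall>v' K' B'. fragment v' K' B' \<longrightarrow> card B \<le> card B')"

text \<open>A vertex \<open>z\<close> at distance two from \<open>x\<close> survives the removal of
  \<open>nbhd {x}\<close>, so the star \<open>{x}\<close> has a fragment.\<close>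

lemma ex_least_fragment:
  assumes "A x y"
  shows "\<exists>v K B. least_fragment v K B"
proof -
  obtain z where z: "A y z" "z \<noteq> x" using deg[OF sym[OF assms]] by blast
  have "\<not> A x z" using no_triangle assms z sym by blast
  then have "fragment x {x} (component (- nbhd {x}) z)"
    using z sym unfolding fragment_def star_def nbhd_def by blast
  then have "\<exists>t. case t of (v, K, B) \<Rightarrow> fragment v K B" by blast
  then have "\<exists>t. (case t of (v, K, B) \<Rightarrow> fragment v K B) \<and>
      (\<forall>t'. (case t' of (v, K, B) \<Rightarrow> fragment v K B) \<longrightarrow> card (snd (snd t)) \<le> card (snd (snd t')))"
    by (elim exE) (rule ex_has_least_nat)
  then show ?thesis unfolding least_fragment_def by fastforce
qed

text \<open>Minimality of \<open>B\<close> forces all of \<open>B\<close> and \<open>nbhd K\<close>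
  outside the closed neighbourhood of \<open>{r, y1, y2, y3}\<close> into one component
  \<open>X\<close>, that of \<open>v\<close>. Each of \<open>z1\<close>, \<open>z2\<close>,
  \<open>z3\<close> sees \<open>X\<close>, so \<open>linked_of_connected\<close> applies.\<close>

lemma linked_in_least_fragment:
  assumes M: "least_fragment v K B"
    and B: "r \<in> B" "y1 \<in> B" "y2 \<in> B" "y3 \<in> B"
    and r: "A r y1" "A r y2" "A r y3" and y: "y1 \<noteq> y2" "y1 \<noteq> y3" "y2 \<noteq> y3"
    and z: "A y1 z1" "A y2 z2" "A y3 z3" "z1 \<noteq> r" "z2 \<noteq> r" "z3 \<noteq> r"
  shows "linked r y1 z1 y2 z2 \<or> linked r y1 z1 y3 z3 \<or> linked r y2 z2 y3 z3"
proof -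
  have fr: "fragment v K B" and least: "\<And>v' K' B'. fragment v' K' B' \<Longrightarrow> card B \<le> card B'"
    using M unfolding least_fragment_def by blast+
  note F = fragmentD[OF fr]
  define K' where "K' = {r, y1, y2, y3}"
  define S where "S = - nbhd K'"
  define X where "X = component S v"
  have K'B: "K' \<subseteq> B" using B K'_def by auto
  \<comment> \<open>No vertex of \<open>K\<close> is in or next to \<open>B\<close>, so
    \<open>K\<close> survives the removal of \<open>nbhd K'\<close>.\<close>
  have KS: "k \<in> S" if "k \<in> K" for k
  proof -
    have "k \<notin> K'" using that F(4) K'B unfolding nbhd_def by blast
    moreover have "\<not> A k' k" if "k' \<in> K'" for k'
      using that \<open>k \<in> K\<close> F(4) K'B sym unfolding nbhd_def by blast
    ultimately show ?thesis unfolding S_def nbhd_def by blast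
  qed
  have vK: "v \<in> K" and Kv: "\<And>k. k \<in> K \<Longrightarrow> k = v \<or> A v k" using F(1) by (auto simp: star_def)
  have vX: "v \<in> X" using component_self X_def by auto
  have XS: "X \<subseteq> S" using component_subset KS[OF vK] X_def by auto
  have Xstep: "b \<in> X" if "a \<in> X" "A a b" "b \<in> S" for a b
    using component_step[of a S v b] that XS X_def by auto
  have KX: "k \<in> X" if "k \<in> K" for k
    using Kv[OF that] Xstep[OF vX _ KS[OF that]] vX by auto
  have nKX: "u \<in> X" if "u \<in> S" "u \<in> nbhd K" for u
    using that KX Xstep unfolding nbhd_def by blast
  \<comment> \<open>A component \<open>U\<close> of \<open>S\<close> that meets \<open>B\<close> but
    not \<open>X\<close> avoids \<open>nbhd K\<close>; hence it lies in \<open>B\<close> and misses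
    \<open>r\<close>, a smaller fragment for the star \<open>K'\<close>.\<close>
  have BX: "u \<in> X" if u: "u \<in> S" "u \<in> B" for u
  proof (rule ccontr)
    assume "u \<notin> X"
    define U where "U = component S u"
    have US: "U \<subseteq> S" using component_subset u(1) U_def by auto
    have "t \<notin> nbhd K" if "t \<in> U" for t
    proof
      assume "t \<in> nbhd K"
      then have "t \<in> X" using nKX US that by blast
      then show False using \<open>u \<notin> X\<close> component_trans component_sym that unfolding X_def U_def by blast
    qed
    then have "U \<subseteq> component (- nbhd K) u" using component_mono[of S u "- nbhd K"] U_def by auto
    then have "U \<subseteq> B" using F(6)[OF u(2)] by simp
    moreover have "r \<notin> U" using US unfolding S_def K'_def nbhd_def by auto
    ultimately have "U \<subset> B" using B(1) by blast
    then have "card U < card B" using F(3) by (rule psubset_card_mono[rotated])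
    moreover have "fragment r K' U"
      unfolding fragment_def using u F(5) r
      by (auto simp: star_def K'_def S_def U_def)
    ultimately show False using least by fastforce
  qed
  have con: "(adj_within X)\<^sup>*\<^sup>* a b" if "a \<in> X" "b \<in> X" for a b
    using component_connected that unfolding X_def by blast
  have far: "a \<noteq> b \<and> \<not> A b a" if "a \<in> X" "b \<in> {r, y1, y2, y3}" for a b
    using that XS unfolding S_def nbhd_def K'_def by blast
  \<comment> \<open>If \<open>z\<close> is in \<open>nbhd K\<close>, it has a neighbour in
    \<open>K\<close>. Otherwise \<open>z\<close> is in \<open>B\<close>, and a further neighbour
    \<open>u\<close> of \<open>z\<close> is neither in \<open>K'\<close> nor adjacent to it, as that
    would give a cycle of length at most five.\<close>
  have att: "\<exists>u\<in>X. A z u" if y: "y \<in> {y1, y2, y3}" and z: "A y z" "z \<noteq> r" for y z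
  proof (cases "z \<in> nbhd K")
    case True
    have "y \<notin> nbhd K" using y B F(4) by auto
    then have "z \<notin> K" using z(1) sym unfolding nbhd_def by blast
    then show ?thesis using True KX sym unfolding nbhd_def by blast
  next
    case False
    then have zB: "z \<in> B" using F(7)[of y z] y B z by auto
    obtain u where u: "A z u" "u \<noteq> y" using deg[OF sym[OF z(1)]] by blast
    have ry: "A r y" using y r by auto
    have nr: "\<not> A r z" "\<not> A r u" "u \<noteq> r"
      using no_triangle[of r y z] no_square[of r y z u] ry z u sym by blast+
    have "u \<noteq> y' \<and> \<not> A y' u" if y': "A r y'" for y'
    proof (cases "y' = y")
      case True
      then show ?thesis using u no_triangle[of y z u] z(1) sym by blast
    next
      case F: False
      have 1: "u \<noteq> y'" using nr y' by blast
      have "z \<noteq> y'" using nr y' by blast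
      then have "distinct [r, y, z, u, y']" using F 1 u z nr ry neq y' by auto
      then have "\<not> A y' u" using no_pentagon[of r y z u y'] ry z u y' sym by blast
      with 1 show ?thesis by blast
    qed
    then have "u \<in> S" using nr r unfolding S_def K'_def nbhd_def by auto
    then have "u \<in> X" using nKX BX F(7)[OF zB u(1)] by blast
    then show ?thesis using u(1) by blast
  qed
  show ?thesis
    by (rule linked_of_connected[OF r y z con far]) (use att z in auto)
qed

lemma linkedD:
  assumes "linked w y z y' z'"
  shows "A w y" "A y z" "A w y'" "A y' z'" "z \<noteq> w" "z' \<noteq> w" "y \<noteq> y'"
  using assms sym unfolding linked_def cycle_in_def
  by (auto simp: successively_Cons successively_append_iff)

text \<open>A vertex \<open>w\<close> of a least fragment outside \<open>ball v 4\<close> has its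
  first and second neighbours in \<open>B\<close>, since \<open>nbhd K\<close> lies within
  \<open>ball v 2\<close>. So \<open>linked_in_least_fragment\<close> applies at \<open>w\<close>
  and at its neighbours.\<close>

lemma no_min_degree3: "\<not> A x y"
proof
  assume "A x y"
  then obtain v K B where M: "least_fragment v K B" using ex_least_fragment by blast
  then have fr: "fragment v K B" unfolding least_fragment_def by blast
  note F = fragmentD[OF fr]
  obtain w where w: "w \<in> B" "w \<notin> ball v 4" using fragment_deep[OF fr] by blast
  have b1: "y \<notin> ball v 3" if "A w y" for y
    using ball_step[of y v 3 w] sym[OF that] w(2) by auto
  have b2: "z \<notin> ball v 2" if "A w y" "A y z" for y z
    using ball_step[of z v 2 y] sym[OF that(2)] b1[OF that(1)] by auto
  have K2: "nbhd K \<subseteq> ball v 2" using star_nbhd_subset_ball F(1) by blast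
  have yB: "y \<in> B" if "A w y" for y
    using F(7)[OF w(1) that] b1[OF that] K2 ball_mono[of 2 3 v] by auto
  have zB: "z \<in> B" if "A w y" "A y z" for y z
    using F(7)[OF yB[OF that(1)] that(2)] b2[OF that] K2 by auto
  \<comment> \<open>By \<open>linked_fork\<close>, any two of \<open>w\<close>, \<open>b\<close>,
    \<open>b'\<close> are linked around \<open>y'\<close>. New continuations \<open>y2\<close>,
    \<open>c2\<close>, \<open>c3\<close> must again give a link for some pair, which
    \<open>linked_disjoint\<close> forbids beside the old one.\<close>
  have fork: "b = b'" if L: "linked w y a y' b" "linked w y a y' b'" for y a y' b b'
  proof (rule ccontr)
    assume bb: "b \<noteq> b'"
    obtain c c' where c: "linked y' w y b c" "linked y' w y b' c'" "linked y' b c b' c'"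
      using linked_fork[OF L bb] by blast
    note D = linkedD[OF c(1)] linkedD[OF c(2)] linkedD[OF c(3)]
    obtain y2 where y2: "A w y2" "y2 \<noteq> y" "y2 \<noteq> y'" using deg[OF D(2)] by blast
    obtain c2 where c2: "A b c2" "c2 \<noteq> c" "c2 \<noteq> y'" using deg[OF D(4)] by blast
    obtain c3 where c3: "A b' c3" "c3 \<noteq> c'" "c3 \<noteq> y'" using deg[OF D(11)] by blast
    have "A w y'" using D(1) sym by blast
    then have "y' \<in> B" "b \<in> B" "b' \<in> B" using yB zB D(3,10) by blast+
    then have "linked y' w y2 b c2 \<or> linked y' w y2 b' c3 \<or> linked y' b c2 b' c3"
      by (intro linked_in_least_fragment[OF M _ w(1)]) (use D y2 c2 c3 in blast)+
    then show False
    proof (elim disjE)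
      assume "linked y' w y2 b c2"
      then show False using linked_disjoint[OF _ c(1)] y2(2) c2(2) by blast
    next
      assume "linked y' w y2 b' c3"
      then show False using linked_disjoint[OF _ c(2)] y2(2) c3(2) by blast
    next
      assume "linked y' b c2 b' c3"
      then show False using linked_disjoint[OF _ c(3)] c2(2) c3(2) by blast
    qed
  qed
  \<comment> \<open>Links from two choices of \<open>a\<close> would end in the same
    \<open>b\<close> by \<open>linked_disjoint\<close>, and then contradict \<open>fork\<close> read
    from the side of \<open>y'\<close>.\<close>
  have free: "\<exists>a. A y a \<and> a \<noteq> w \<and> (\<forall>b. \<not> linked w y a y' b)" if wy: "A w y" for y y'
  proof (rule ccontr)
    assume n: "\<not> ?thesis"
    obtain a where a: "A y a" "a \<noteq> w" using deg[OF sym[OF wy]] by blast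
    obtain a' where a': "A y a'" "a' \<noteq> w" "a' \<noteq> a" using deg[OF sym[OF wy]] by blast
    obtain b b' where b: "linked w y a y' b" "linked w y a' y' b'" using n a a' by blast
    then have "b = b'" using linked_disjoint a'(3) by blast
    then have "a = a'" using fork[of y' b y a a'] linked_sym b by blast
    then show False using a'(3) by blast
  qed
  obtain y1 where y1: "A w y1" using F(5) w(1) by blast
  obtain y2 where y2: "A w y2" "y2 \<noteq> y1" using deg[OF y1] by blast
  obtain y3 where y3: "A w y3" "y3 \<noteq> y1" "y3 \<noteq> y2" using deg[OF y1] by blast
  \<comment> \<open>Cyclic choice: \<open>a1\<close> rules out the pair \<open>y1, y2\<close>,
    \<open>a2\<close> the pair \<open>y2, y3\<close>, and \<open>a3\<close> the pair
    \<open>y3, y1\<close>.\<close>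
  obtain a1 where a1: "A y1 a1" "a1 \<noteq> w" "\<And>b. \<not> linked w y1 a1 y2 b" using free[OF y1] by blast
  obtain a2 where a2: "A y2 a2" "a2 \<noteq> w" "\<And>b. \<not> linked w y2 a2 y3 b" using free[OF y2(1)] by blast
  obtain a3 where a3: "A y3 a3" "a3 \<noteq> w" "\<And>b. \<not> linked w y3 a3 y1 b" using free[OF y3(1)] by blast
  have "linked w y1 a1 y2 a2 \<or> linked w y1 a1 y3 a3 \<or> linked w y2 a2 y3 a3"
    by (rule linked_in_least_fragment[OF M w(1)]) (use y1 y2 y3 a1 a2 a3 yB in blast)+
  then show False using a1(3) a2(3) a3(3) linked_sym by blast
qed

end

section \<open>Colouring\<close>

context long_girth begin

lemma ex_degree_le_2:
  assumes "A x y"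
  shows "\<exists>x a b. (\<exists>y. A x y) \<and> (\<forall>z. A x z \<longrightarrow> z = a \<or> z = b)"
proof (rule ccontr)
  assume n: "\<not> ?thesis"
  have "min_degree3 A l"
  proof
    show "\<exists>z. A x z \<and> z \<noteq> a \<and> z \<noteq> b" if "A x y" for x y a b
      using n that by blast
  qed
  from min_degree3.no_min_degree3[OF this] assms show False by blast
qed

text \<open>A cycle of the restriction has all its vertices in \<open>W\<close>, hence the same
  chords in \<open>A\<close>: holes of an induced subgraph are holes of the graph.\<close>

lemma long_girth_restrict: "long_girth (adj_within W) l"
proof
  have W: "set c \<subseteq> W" if c: "cycle_in (adj_within W) c" for c
  proof
    fix x assume "x \<in> set c"
    then obtain i where i: "i < length c" "x = c ! i" by (auto simp: in_set_conv_nth)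
    have ne: "c \<noteq> []" using c by (auto simp: cycle_in_def)
    show "x \<in> W"
    proof (cases "Suc i < length c")
      case True
      then show ?thesis using c i successively_nth[of _ c i] unfolding cycle_in_def by blast
    next
      case False
      then have "x = last c" using i ne by (metis last_conv_nth Suc_lessI diff_Suc_1)
      then show ?thesis using c unfolding cycle_in_def by blast
    qed
  qed
  have cyc: "cycle_in A c" if "cycle_in (adj_within W) c" for c
    using that successively_mono[of "adj_within W" c A] unfolding cycle_in_def by auto
  show "2 * l \<le> length c" if "cycle_in (adj_within W) c" for c
    using girth cyc that by blast
  show "length c = 2 * l"
    if c: "cycle_in (adj_within W) c" "chordless (adj_within W) c" "even (length c)" for c
  proof -
    have "chordless A c"
      unfolding chordless_def
    proof (intro allI impI)
      fix i j assume ij: "i < j" "j < length c" "A (c ! i) (c ! j)"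
      then have "c ! i \<in> W" "c ! j \<in> W" using W[OF c(1)] nth_mem[of i c] nth_mem[of j c] by auto
      then show "j = Suc i \<or> i = 0 \<and> Suc j = length c" using c(2) ij unfolding chordless_def by blast
    qed
    then show ?thesis using even_hole cyc c by blast
  qed
  show "finite {x. \<exists>y. adj_within W x y}"
    by (rule finite_subset[OF _ finite_nonisolated]) auto
  show "adj_within W y x" if "adj_within W x y" for x y using that sym by blast
  show "\<not> adj_within W x x" for x using irrefl by blast
  show "5 \<le> l" by (rule l_ge)
qed

text \<open>Degeneracy argument: remove a vertex with at most two neighbours in \<open>W\<close>,
  colour the rest, and give that vertex a colour its neighbours leave free.\<close>

lemma three_colouring:
  assumes "finite W"
  shows "\<exists>c :: 'a \<Rightarrow> nat. (\<forall>x\<in>W. c x < 3) \<and> (\<forall>x\<in>W. \<forall>y\<in>W. A x y \<longrightarrow> c x \<noteq> c y)"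
  using assms
proof (induction W rule: finite_psubset_induct)
  case (psubset W)
  interpret R: long_girth "adj_within W" l by (rule long_girth_restrict)
  show ?case
  proof (cases "\<exists>x y. adj_within W x y")
    case False
    then show ?thesis by (intro exI[of _ "\<lambda>_. 0"]) auto
  next
    case True
    then obtain x' y' where "adj_within W x' y'" by blast
    from R.ex_degree_le_2[OF this]
    obtain x a b where x: "\<exists>y. adj_within W x y" "\<forall>z. adj_within W x z \<longrightarrow> z = a \<or> z = b"
      by blast
    then have "W - {x} \<subset> W" by blast
    from psubset.IH[OF this] obtain c :: "'a \<Rightarrow> nat" where
      c: "\<forall>u\<in>W - {x}. c u < 3" "\<forall>u\<in>W - {x}. \<forall>y\<in>W - {x}. A u y \<longrightarrow> c u \<noteq> c y" by blast
    have "\<exists>k::nat. k < 3 \<and> k \<noteq> i \<and> k \<noteq> j" for i j by presburger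
    then obtain k where k: "k < 3" "k \<noteq> c a" "k \<noteq> c b" by blast
    have xk: "k \<noteq> c z" if "A x z" "z \<in> W" for z
    proof -
      have "x \<in> W" using x(1) by blast
      then show ?thesis using x(2) k(2,3) that by auto
    qed
    show ?thesis
    proof (intro exI conjI ballI impI)
      show "(c(x := k)) u < 3" if "u \<in> W" for u using c(1) k(1) that by auto
      show "(c(x := k)) u \<noteq> (c(x := k)) y" if "u \<in> W" "y \<in> W" "A u y" for u y
      proof -
        have "u \<noteq> y" using neq that(3) .
        then consider "u = x" "y \<noteq> x" | "y = x" "u \<noteq> x" | "u \<noteq> x" "y \<noteq> x" by blast
        then show ?thesis
        proof cases
          case 1
          then show ?thesis using xk[of y] that by simp
        next
          case 2
          then have "A x u" using that(3) sym by blast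
          then show ?thesis using xk[of u] that(1) 2 by simp
        next
          case 3
          then have "c u \<noteq> c y" using c(2) that by blast
          then show ?thesis using 3 by simp
        qed
      qed
    qed
  qed
qed

end

section \<open>From vertex lists to cycles and holes of a \<open>pair_graph\<close>\<close>

definition closed_arcs :: "'a list \<Rightarrow> ('a \<times> 'a) awalk" where
  "closed_arcs c = zip c (tl c @ [hd c])"

lemma length_closed_arcs [simp]: "length (closed_arcs c) = length c"
  by (cases c) (auto simp: closed_arcs_def)

lemma pcas_zip: "pcas u (zip (u # q) (q @ [t])) t"
  by (induction q arbitrary: u) auto

lemma pawalk_verts_zip: "pawalk_verts u (zip (u # q) (q @ [t])) = u # q @ [t]"
  by (induction q arbitrary: u) auto

lemma set_zip_successively:
  "successively (\<lambda>x y. (x, y) \<in> E) (u # q @ [t]) \<Longrightarrow> set (zip (u # q) (q @ [t])) \<subseteq> E"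
  by (induction q arbitrary: u) auto

context pair_graph begin

lemma graph_cycle_closed_arcs:
  assumes c: "cycle_in (\<lambda>x y. (x, y) \<in> parcs G) c"
  shows "graph_cycle G (closed_arcs c)" "set (closed_arcs c) \<subseteq> parcs G"
proof -
  obtain u q where u: "c = u # q" using c by (cases c) (auto simp: cycle_in_def)
  have z: "closed_arcs c = zip (u # q) (q @ [u])" by (simp add: closed_arcs_def u)
  have q: "q \<noteq> []" using c u by (auto simp: cycle_in_def)
  have "successively (\<lambda>x y. (x, y) \<in> parcs G) (u # q @ [u])"
    using c q u by (auto simp: cycle_in_def successively_Cons successively_append_iff)
  then show s: "set (closed_arcs c) \<subseteq> parcs G" unfolding z by (rule set_zip_successively)
  have "(last c, u) \<in> parcs G" using c u by (simp add: cycle_in_def)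
  then have "u \<in> pverts G" by (rule in_arcsD2)
  then have "awalk u (closed_arcs c) u"
    using s pcas_zip[of u q u] unfolding awalk_def z by simp
  moreover have "distinct (tl (pawalk_verts u (closed_arcs c)))"
    using c u unfolding z pawalk_verts_zip by (auto simp: cycle_in_def)
  moreover have "closed_arcs c \<noteq> []" using u by (simp add: closed_arcs_def)
  ultimately have "cycle (closed_arcs c)" unfolding cycle_def by blast
  then show "graph_cycle G (closed_arcs c)"
    using c by (simp add: graph_cycle_def cycle_in_def)
qed

text \<open>By chordlessness, an arc of \<open>G\<close> between two vertices of \<open>c\<close>
  joins cyclically consecutive ones, so the cycle is an induced subgraph.\<close>

lemma hole_closed_arcs:
  assumes c: "cycle_in (\<lambda>x y. (x, y) \<in> parcs G) c" "chordless (\<lambda>x y. (x, y) \<in> parcs G) c"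
    and len: "4 \<le> length c"
  shows "hole G (closed_arcs c)"
proof -
  let ?H = "cycle_subgraph (closed_arcs c)"
  note gc = graph_cycle_closed_arcs[OF c(1)]
  have ne: "c \<noteq> []" using len by auto
  have lt: "length (tl c @ [hd c]) = length c" using ne by simp
  have nth_next: "(tl c @ [hd c]) ! i = (if Suc i < length c then c ! Suc i else c ! 0)" if "i < length c" for i
    using that ne by (auto simp: nth_append nth_tl hd_conv_nth less_Suc_eq)
  have arc: "(c ! i, if Suc i < length c then c ! Suc i else c ! 0) \<in> set (closed_arcs c)" if "i < length c" for i
    unfolding closed_arcs_def set_zip using that nth_next[OF that] lt by auto
  have fH: "fst ` set (closed_arcs c) = set c"
    using lt by (simp add: closed_arcs_def flip: set_map)
  then have vH: "pverts ?H = set c" by (simp add: cycle_subgraph_def)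
  have "snd ` set (closed_arcs c) = set (tl c @ [hd c])"
    using lt by (simp add: closed_arcs_def flip: set_map)
  also have "\<dots> = set c" using ne by (cases c) auto
  finally have sH: "snd ` set (closed_arcs c) = set c" .
  have aH: "parcs ?H = set (closed_arcs c) \<union> (set (closed_arcs c))\<inverse>"
    by (simp add: cycle_subgraph_def)
  have ends: "a \<in> set c" "b \<in> set c" if "(a, b) \<in> parcs ?H" for a b
    using that image_eqI[of _ fst "(a, b)"] image_eqI[of _ snd "(a, b)"]
      image_eqI[of _ fst "(b, a)"] image_eqI[of _ snd "(b, a)"] sH fH unfolding aH by auto
  have sub: "parcs ?H \<subseteq> parcs G" using gc(2) arcs_symmetric unfolding aH by blast
  have "wf_digraph (with_proj ?H)"
    unfolding wf_digraph_wp_iff by unfold_locales (use ends vH in auto)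
  moreover have "set c \<subseteq> pverts G"
    using gc(2) arc_fst_in_verts unfolding fH[symmetric] by blast
  ultimately have "subgraph (with_proj ?H) (with_proj G)"
    using sub vH wf_digraph_axioms by (auto simp: subgraph_def)
  moreover have "(a, b) \<in> parcs ?H" if ab: "(a, b) \<in> parcs G" "a \<in> set c" "b \<in> set c" for a b
  proof -
    have lt_case: "(c ! i, c ! j) \<in> set (closed_arcs c) \<or> (c ! j, c ! i) \<in> set (closed_arcs c)"
      if "i < j" "j < length c" "(c ! i, c ! j) \<in> parcs G" for i j
    proof -
      have "j = Suc i \<or> i = 0 \<and> Suc j = length c" using c(2) that unfolding chordless_def by blast
      then show ?thesis using arc[of i] arc[of j] that by auto
    qed
    obtain i j where ij: "i < length c" "a = c ! i" "j < length c" "b = c ! j"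
      using ab by (auto simp: in_set_conv_nth)
    have "i \<noteq> j" using ab(1) no_loops' ij by auto
    then show ?thesis
      using lt_case[of i j] lt_case[of j i] ij ab(1) arcs_symmetric[OF ab(1)] unfolding aH
      by (cases "i < j") auto
  qed
  then have "parcs ?H = {e \<in> parcs G. fst e \<in> pverts ?H \<and> snd e \<in> pverts ?H}"
    using sub ends vH by auto
  ultimately have "induced_subgraph (with_proj ?H) (with_proj G)"
    by (simp add: induced_subgraph_def)
  then show ?thesis using gc(1) len by (simp add: hole_def)
qed

end

theorem theorem1p3:
  fixes G :: "'a pair_pre_digraph" and l :: nat
  assumes "5 \<le> l"
    and "pair_graph G"
    and "girth G = enat (2 * l)"
    and "\<not> (\<exists>p. even_hole G p \<and> 2 * l + 2 \<le> length p)"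
  shows "colorable 3 G"
proof -
  interpret pair_graph G by fact
  let ?A = "\<lambda>x y. (x, y) \<in> parcs G"
  have girth_le: "2 * l \<le> length c" if "cycle_in ?A c" for c
  proof -
    have "girth G \<le> enat (length (closed_arcs c))"
      unfolding girth_def by (rule INF_lower) (use graph_cycle_closed_arcs[OF that] in simp)
    then show ?thesis using assms(3) by simp
  qed
  interpret long_girth ?A l
  proof
    show "length c = 2 * l" if c: "cycle_in ?A c" "chordless ?A c" "even (length c)" for c
    proof -
      have "hole G (closed_arcs c)"
        using hole_closed_arcs[OF c(1,2)] girth_le[OF c(1)] assms(1) by simp
      \<comment> \<open>With the girth bound only \<open>2 * l\<close> and \<open>2 * l + 1\<close>
        remain, and parity excludes the latter.\<close>
      then have "length c < 2 * l + 2"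
        using assms(4) c(3) unfolding even_hole_def by fastforce
      then show ?thesis using girth_le[OF c(1)] c(3) by presburger
    qed
    show "finite {x. \<exists>y. (x, y) \<in> parcs G}"
      by (rule finite_subset[OF _ pair_finite_verts]) (auto dest: in_arcsD1)
    show "(y, x) \<in> parcs G" if "(x, y) \<in> parcs G" for x y by (rule arcs_symmetric[OF that])
    show "(x, x) \<notin> parcs G" for x using no_loops'[of x x] by blast
    show "5 \<le> l" by fact
    show "2 * l \<le> length c" if "cycle_in ?A c" for c by (rule girth_le[OF that])
  qed
  obtain c :: "'a \<Rightarrow> nat" where c: "\<forall>x\<in>pverts G. c x < 3"
    "\<forall>x\<in>pverts G. \<forall>y\<in>pverts G. (x, y) \<in> parcs G \<longrightarrow> c x \<noteq> c y"
    using three_colouring[OF pair_finite_verts] by blast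
  have "c u \<noteq> c v" if "(u, v) \<in> parcs G" for u v
    using c(2) in_arcsD1[OF that] in_arcsD2[OF that] that by blast
  then show ?thesis unfolding colorable_def using c(1) by (intro exI[of _ c]) auto
qed

end
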